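(* Let $G=(V(G),E(G))$ be a simple graph with nonempty vertex set, and put $X := V(G)\times\mathbb{Z}_2$. Define a map $s: X\to \mathrm{Map}(X,X)$ by $$s_{(v,a)}(w,b) := (w,\, b+e(v,w)),$$ where $e: V(G)\times V(G)\to\mathbb{Z}_2$ is the adjacency function of $G$, i.e. $e(v,w)=1$ if $v$ and $w$ are joined by an edge and $e(v,w)=0$ otherwise. Then $Q_G := (X,s)$ is a disconnected quandle, and its inner automorphism group is abelian. Furthermore, $Q_G$ is homogeneous if and only if the graph $G$ is vertex-transitive.
   Context: $\mathbb{Z}_2=\mathbb{Z}/2\mathbb{Z}$. A simple graph is an undirected graph without loops or multiple edges; it is not assumed finite. It is vertex-transitive if its graph automorphism group acts transitively on $V(G)$. A quandle is a pair $(X,s)$ of a set $X$ and a map $s : X \to \mathrm{Map}(X,X)$, $x \mapsto s_x$, such that (Q1) $s_x(x)=x$ for all $x$; (Q2) every $s_x$ is bijective; (Q3) $s_x\circ s_y = s_{s_x(y)}\circ s_x$ for all $x,y\in X$. An automorphism of $(X,s)$ is a bijection $f:X\to X$ with $f\circ s_x = s_{f(x)}\circ f$ for all $x\in X$; $\mathrm{Aut}(X,s)$ is the group of automorphisms. The inner automorphism group $\mathrm{Inn}(X,s)$ is the group generated by $\{s_x \mid x\in X\}$. The quandle is homogeneous if $\mathrm{Aut}(X,s)$ acts transitively on $X$, connected if $\mathrm{Inn}(X,s)$ acts transitively on $X$, and disconnected if it is not connected. *)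

theory Defs
  imports "HOL-Algebra.Group_Action" "HOL-Algebra.Generated_Groups" "HOL-Library.Z2"
    "Graph_Theory.Pair_Digraph"
begin

section \<open>Quandles\<close>

text \<open>The map \<open>s\<close> is a total HOL function, but only its values on \<open>X\<close> are meaningful.\<close>

locale quandle =
  fixes X :: "'a set" and s :: "'a \<Rightarrow> 'a \<Rightarrow> 'a"
  assumes Q1: "x \<in> X \<Longrightarrow> s x x = x"
    and Q2: "x \<in> X \<Longrightarrow> bij_betw (s x) X X"
    and Q3: "\<lbrakk>x \<in> X; y \<in> X; z \<in> X\<rbrakk> \<Longrightarrow> s x (s y z) = s (s x y) (s x z)"

text \<open>Permutation groups of \<open>X\<close> are represented as subgroups of \<^term>\<open>BijGroup X\<close>, whose elements
  are the bijections of \<open>X\<close> that are undefined outside \<open>X\<close>; hence the restriction of the maps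
  \<open>s x\<close> in the inner automorphism group.\<close>

definition quandle_aut :: "'a set \<Rightarrow> ('a \<Rightarrow> 'a \<Rightarrow> 'a) \<Rightarrow> ('a \<Rightarrow> 'a) set" where
  "quandle_aut X s = {f \<in> Bij X. \<forall>x\<in>X. \<forall>y\<in>X. f (s x y) = s (f x) (f y)}"

definition Aut_group :: "'a set \<Rightarrow> ('a \<Rightarrow> 'a \<Rightarrow> 'a) \<Rightarrow> ('a \<Rightarrow> 'a) monoid" where
  "Aut_group X s = (BijGroup X)\<lparr>carrier := quandle_aut X s\<rparr>"

definition Inn_group :: "'a set \<Rightarrow> ('a \<Rightarrow> 'a \<Rightarrow> 'a) \<Rightarrow> ('a \<Rightarrow> 'a) monoid" where
  "Inn_group X s =
    (BijGroup X)\<lparr>carrier := generate (BijGroup X) ((\<lambda>x. restrict (s x) X) ` X)\<rparr>"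

definition homogeneous_quandle :: "'a set \<Rightarrow> ('a \<Rightarrow> 'a \<Rightarrow> 'a) \<Rightarrow> bool" where
  "homogeneous_quandle X s \<longleftrightarrow> transitive_action (Aut_group X s) X (\<lambda>f. f)"

definition connected_quandle :: "'a set \<Rightarrow> ('a \<Rightarrow> 'a \<Rightarrow> 'a) \<Rightarrow> bool" where
  "connected_quandle X s \<longleftrightarrow> transitive_action (Inn_group X s) X (\<lambda>f. f)"

section \<open>Graphs\<close>

text \<open>An undirected graph is a symmetric digraph: vertices \<open>v\<close> and \<open>w\<close> are joined by an edge iff
  both \<open>(v, w)\<close> and \<open>(w, v)\<close> are arcs. Since the arcs form a set of pairs, there are no multiple
  edges, and finiteness is not assumed.\<close>

abbreviation simple_graph :: "'v pair_pre_digraph \<Rightarrow> bool" where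
  "simple_graph \<equiv> pair_bidirected_digraph"

definition graph_aut :: "'v pair_pre_digraph \<Rightarrow> ('v \<Rightarrow> 'v) set" where
  "graph_aut G = {f \<in> Bij (pverts G).
    \<forall>v\<in>pverts G. \<forall>w\<in>pverts G. (v, w) \<in> parcs G \<longleftrightarrow> (f v, f w) \<in> parcs G}"

definition graph_Aut_group :: "'v pair_pre_digraph \<Rightarrow> ('v \<Rightarrow> 'v) monoid" where
  "graph_Aut_group G = (BijGroup (pverts G))\<lparr>carrier := graph_aut G\<rparr>"

definition vertex_transitive :: "'v pair_pre_digraph \<Rightarrow> bool" where
  "vertex_transitive G \<longleftrightarrow> transitive_action (graph_Aut_group G) (pverts G) (\<lambda>f. f)"

definition adjacency :: "'v pair_pre_digraph \<Rightarrow> 'v \<Rightarrow> 'v \<Rightarrow> bit" where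
  "adjacency G v w = (if (v, w) \<in> parcs G then 1 else 0)"

section \<open>The quandle of a graph\<close>

definition QG_set :: "'v pair_pre_digraph \<Rightarrow> ('v \<times> bit) set" where
  "QG_set G = pverts G \<times> UNIV"

definition QG_map :: "'v pair_pre_digraph \<Rightarrow> 'v \<times> bit \<Rightarrow> 'v \<times> bit \<Rightarrow> 'v \<times> bit" where
  "QG_map G = (\<lambda>(v, a) (w, b). (w, b + adjacency G v w))"

section \<open>The automorphism groups act by permutations\<close>

lemma transitive_action_BijGroup_iff:
  assumes "subgroup H (BijGroup X)"
  shows "transitive_action ((BijGroup X)\<lparr>carrier := H\<rparr>) X (\<lambda>f. f)
    \<longleftrightarrow> (\<forall>x\<in>X. \<forall>y\<in>X. \<exists>f\<in>H. f x = y)"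
proof -
  interpret B: group "BijGroup X" by (rule group_BijGroup)
  have "group_hom ((BijGroup X)\<lparr>carrier := H\<rparr>) (BijGroup X) (\<lambda>f. f)"
    using assms B.subgroup_imp_group[OF assms] B.group_axioms subgroup.mem_carrier[OF assms]
    by (auto simp: group_hom_def group_hom_axioms_def hom_def)
  then show ?thesis
    by (auto simp: transitive_action_def transitive_action_axioms_def group_action_def)
qed

lemma subgroup_BijGroupI:
  assumes "H \<subseteq> Bij X" "(\<lambda>x\<in>X. x) \<in> H"
    and "\<And>f g. \<lbrakk>f \<in> H; g \<in> H\<rbrakk> \<Longrightarrow> compose X f g \<in> H"
    and "\<And>f. f \<in> H \<Longrightarrow> restrict (inv_into X f) X \<in> H"
  shows "subgroup H (BijGroup X)"
proof (rule group.subgroupI[OF group_BijGroup])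
  show "H \<subseteq> carrier (BijGroup X)" "H \<noteq> {}"
    using assms(1,2) by (auto simp: BijGroup_def)
  show "inv\<^bsub>BijGroup X\<^esub> f \<in> H" if "f \<in> H" for f
    using assms(1) assms(4)[OF that] that by (simp add: inv_BijGroup subset_iff)
  show "f \<otimes>\<^bsub>BijGroup X\<^esub> g \<in> H" if "f \<in> H" "g \<in> H" for f g
    using assms(1) assms(3)[OF that] that by (simp add: BijGroup_def subset_iff)
qed

lemma Bij_inv_into_simps:
  assumes "f \<in> Bij X" "x \<in> X"
  shows "f x \<in> X" "inv_into X f x \<in> X" "f (inv_into X f x) = x" "inv_into X f (f x) = x"
  using assms by (auto simp: Bij_def bij_betw_def inv_into_into f_inv_into_f)

lemma (in quandle) s_closed: "\<lbrakk>x \<in> X; y \<in> X\<rbrakk> \<Longrightarrow> s x y \<in> X"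
  using Q2 bij_betwE by metis

lemma (in quandle) subgroup_quandle_aut: "subgroup (quandle_aut X s) (BijGroup X)"
proof (rule subgroup_BijGroupI)
  fix f assume f: "f \<in> quandle_aut X s"
  then have B: "f \<in> Bij X" by (simp add: quandle_aut_def)
  have "inv_into X f (s x y) = s (inv_into X f x) (inv_into X f y)" if xy: "x \<in> X" "y \<in> X" for x y
    using f B xy s_closed
    by (intro Bij_inv_into_lemma[where h = f and S = X]) (auto simp: quandle_aut_def)
  then show "restrict (inv_into X f) X \<in> quandle_aut X s"
    using restrict_inv_into_Bij[OF B] s_closed by (simp add: quandle_aut_def)
next
  fix f g assume fg: "f \<in> quandle_aut X s" "g \<in> quandle_aut X s"
  then have "\<And>x. x \<in> X \<Longrightarrow> g x \<in> X"
    by (auto simp: quandle_aut_def dest: Bij_imp_funcset)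
  with fg show "compose X f g \<in> quandle_aut X s"
    by (simp add: quandle_aut_def compose_Bij compose_eq s_closed)
qed (auto simp: quandle_aut_def id_Bij s_closed)

lemma (in quandle) subgroup_Inn:
  "subgroup (generate (BijGroup X) ((\<lambda>x. restrict (s x) X) ` X)) (BijGroup X)"
  using Q2 by (intro group.generate_is_subgroup[OF group_BijGroup])
    (auto simp: BijGroup_def Bij_def)

lemma (in quandle) Inn_le_Aut: "carrier (Inn_group X s) \<subseteq> carrier (Aut_group X s)"
proof -
  have "restrict (s x) X \<in> quandle_aut X s" if "x \<in> X" for x
  proof -
    have "restrict (s x) X \<in> Bij X"
      using Q2[OF that] by (simp add: Bij_def)
    moreover have "restrict (s x) X (s y z) = s (restrict (s x) X y) (restrict (s x) X z)"
      if "y \<in> X" "z \<in> X" for y z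
      using Q3[OF \<open>x \<in> X\<close> that] s_closed[OF that] that by simp
    ultimately show ?thesis
      unfolding quandle_aut_def by blast
  qed
  then show ?thesis
    using group.generate_subgroup_incl[OF group_BijGroup _ subgroup_quandle_aut]
    by (auto simp: Inn_group_def Aut_group_def image_subset_iff)
qed

lemma (in quandle) homogeneous_quandle_iff:
  "homogeneous_quandle X s \<longleftrightarrow> (\<forall>x\<in>X. \<forall>y\<in>X. \<exists>f\<in>quandle_aut X s. f x = y)"
  unfolding homogeneous_quandle_def Aut_group_def
  by (rule transitive_action_BijGroup_iff[OF subgroup_quandle_aut])

lemma (in quandle) connected_quandle_iff:
  "connected_quandle X s \<longleftrightarrow> (\<forall>x\<in>X. \<forall>y\<in>X. \<exists>f\<in>carrier (Inn_group X s). f x = y)"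
  unfolding connected_quandle_def Inn_group_def
  using transitive_action_BijGroup_iff[OF subgroup_Inn] by simp

lemma restrict_in_graph_autI:
  assumes "restrict f (pverts G) \<in> Bij (pverts G)"
    and "\<And>v w. \<lbrakk>v \<in> pverts G; w \<in> pverts G\<rbrakk> \<Longrightarrow> (v, w) \<in> parcs G \<longleftrightarrow> (f v, f w) \<in> parcs G"
  shows "restrict f (pverts G) \<in> graph_aut G"
proof -
  let ?f = "restrict f (pverts G)"
  have "(v, w) \<in> parcs G \<longleftrightarrow> (?f v, ?f w) \<in> parcs G" if "v \<in> pverts G" "w \<in> pverts G" for v w
    unfolding restrict_apply'[OF that(1)] restrict_apply'[OF that(2)]
    by (rule assms(2)[OF that])
  then show ?thesis
    unfolding graph_aut_def using assms(1) by blast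
qed

lemma subgroup_graph_aut: "subgroup (graph_aut G) (BijGroup (pverts G))"
proof (rule subgroup_BijGroupI)
  show "(\<lambda>v\<in>pverts G. v) \<in> graph_aut G"
    by (rule restrict_in_graph_autI[OF id_Bij refl])
next
  fix f assume f: "f \<in> graph_aut G"
  then have B: "f \<in> Bij (pverts G)" by (simp add: graph_aut_def)
  let ?g = "inv_into (pverts G) f"
  have "(v, w) \<in> parcs G \<longleftrightarrow> (?g v, ?g w) \<in> parcs G" if "v \<in> pverts G" "w \<in> pverts G" for v w
  proof -
    have "(?g v, ?g w) \<in> parcs G \<longleftrightarrow> (f (?g v), f (?g w)) \<in> parcs G"
      using f that[THEN Bij_inv_into_simps(2)[OF B]] unfolding graph_aut_def by blast
    then show ?thesis
      by (simp only: that[THEN Bij_inv_into_simps(3)[OF B]])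
  qed
  then show "restrict ?g (pverts G) \<in> graph_aut G"
    by (rule restrict_in_graph_autI[OF restrict_inv_into_Bij[OF B]])
next
  fix f g assume f: "f \<in> graph_aut G" and g: "g \<in> graph_aut G"
  then have B: "f \<in> Bij (pverts G)" "g \<in> Bij (pverts G)" by (simp_all add: graph_aut_def)
  have "(v, w) \<in> parcs G \<longleftrightarrow> (f (g v), f (g w)) \<in> parcs G" if "v \<in> pverts G" "w \<in> pverts G" for v w
    using f g that that[THEN Bij_inv_into_simps(1)[OF B(2)]] unfolding graph_aut_def by blast
  then show "compose (pverts G) f g \<in> graph_aut G"
    using compose_Bij[OF B] unfolding compose_def by (intro restrict_in_graph_autI)
next
  show "graph_aut G \<subseteq> Bij (pverts G)"
    by (simp add: graph_aut_def)
qed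

lemma vertex_transitive_iff:
  "vertex_transitive G \<longleftrightarrow> (\<forall>v\<in>pverts G. \<forall>w\<in>pverts G. \<exists>f\<in>graph_aut G. f v = w)"
  unfolding vertex_transitive_def graph_Aut_group_def
  by (rule transitive_action_BijGroup_iff[OF subgroup_graph_aut])

end

theory Submission
  imports Defs
begin

text \<open>
  Every map \<open>s\<^sub>x\<close> of the quandle of a graph translates each fibre \<open>{w} \<times> \<int>\<^sub>2\<close> of the projection to the
  vertices by a constant. Translations of fibres commute, so the inner automorphism group is
  generated by commuting elements and is abelian. They also preserve the projection, so if this
  group were transitive there would be only one vertex; but over a single loopless vertex every
  \<open>s\<^sub>x\<close> is the identity, and the two points of the fibre cannot be exchanged.

  For homogeneity, the graph can be read off from the quandle: \<open>s\<^sub>x\<close> moves \<open>y\<close> exactly when the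
  vertices under \<open>x\<close> and \<open>y\<close> are adjacent (\<open>QG_map_moves_iff\<close>). A graph automorphism, combined with
  a shift of the second coordinate, is a quandle automorphism (\<open>quandle_aut_liftI\<close>), and these
  lifts are transitive if the graph automorphisms are. Conversely a quandle automorphism always
  respects adjacency. It need not map fibres to fibres, but it does so over vertices that have
  a neighbour, because there some \<open>s\<^sub>x\<close> exchanges the two points of the fibre; if each
  vertex has a neighbour, it therefore descends to a graph automorphism (\<open>graph_aut_descendI\<close>).
  Homogeneity forces either every vertex or no vertex to have a neighbour. In the latter case
  there are no edges, and all permutations of the vertices are automorphisms.
\<close>

section \<open>Inner automorphism groups\<close>

text \<open>Centralizers are subgroups: the generators lie in the centralizer of the generators, hence so
  does the whole group; then the generators lie in the centralizer of the whole group.\<close>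

lemma (in group) generate_commute:
  assumes H: "H \<subseteq> carrier G"
    and comm: "\<And>x y. \<lbrakk>x \<in> H; y \<in> H\<rbrakk> \<Longrightarrow> x \<otimes> y = y \<otimes> x"
    and xy: "x \<in> generate G H" "y \<in> generate G H"
  shows "x \<otimes> y = y \<otimes> x"
proof -
  define C where "C A = {x \<in> carrier G. \<forall>a\<in>A. x \<otimes> a = a \<otimes> x}" for A
  have sub: "subgroup (C A) G" if A: "A \<subseteq> carrier G" for A
  proof (rule subgroupI)
    show "C A \<noteq> {}"
      using A by (force simp: C_def)
    show "inv x \<in> C A" if "x \<in> C A" for x
    proof -
      have "inv x \<otimes> a = a \<otimes> inv x" if "a \<in> A" for a
      proof -
        have x: "x \<in> carrier G" and a: "a \<in> carrier G" and xa: "x \<otimes> a = a \<otimes> x"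
          using \<open>x \<in> C A\<close> \<open>a \<in> A\<close> A by (auto simp: C_def)
        have "inv x \<otimes> a = inv x \<otimes> (a \<otimes> x) \<otimes> inv x"
          using x a by (simp add: m_assoc)
        also have "\<dots> = inv x \<otimes> (x \<otimes> a) \<otimes> inv x"
          by (simp only: xa)
        also have "\<dots> = a \<otimes> inv x"
          using x a by (simp flip: m_assoc)
        finally show ?thesis .
      qed
      with \<open>x \<in> C A\<close> show ?thesis by (simp add: C_def)
    qed
    show "x \<otimes> y \<in> C A" if "x \<in> C A" "y \<in> C A" for x y
      using that A by (auto simp: C_def subset_iff m_assoc) (metis m_assoc)
  qed (auto simp: C_def)
  have "H \<subseteq> C H"
    using H comm by (auto simp: C_def)
  then have "generate G H \<subseteq> C H"
    by (rule generate_subgroup_incl[OF _ sub[OF H]])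
  then have "H \<subseteq> C (generate G H)"
    using H by (auto simp: C_def)
  then have "generate G H \<subseteq> C (generate G H)"
    by (rule generate_subgroup_incl[OF _ sub[OF generate_incl[OF H]]])
  with xy show ?thesis by (auto simp: C_def)
qed

lemma (in quandle) restrict_s_Bij: "x \<in> X \<Longrightarrow> restrict (s x) X \<in> Bij X"
  using Q2 by (simp add: Bij_def)

lemma (in quandle) comm_group_InnI:
  assumes comm: "\<And>x y z. \<lbrakk>x \<in> X; y \<in> X; z \<in> X\<rbrakk> \<Longrightarrow> s x (s y z) = s y (s x z)"
  shows "comm_group (Inn_group X s)"
proof -
  interpret B: group "BijGroup X" by (rule group_BijGroup)
  let ?S = "(\<lambda>x. restrict (s x) X) ` X"
  have S: "?S \<subseteq> carrier (BijGroup X)"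
    using restrict_s_Bij by (auto simp: BijGroup_def)
  have S_comm: "restrict (s x) X \<otimes>\<^bsub>BijGroup X\<^esub> restrict (s y) X
      = restrict (s y) X \<otimes>\<^bsub>BijGroup X\<^esub> restrict (s x) X" if "x \<in> X" "y \<in> X" for x y
    using that comm restrict_s_Bij s_closed
    by (auto simp: BijGroup_def compose_def fun_eq_iff restrict_def)
  have "f \<otimes>\<^bsub>BijGroup X\<^esub> g = g \<otimes>\<^bsub>BijGroup X\<^esub> f"
    if "f \<in> generate (BijGroup X) ?S" "g \<in> generate (BijGroup X) ?S" for f g
    by (rule B.generate_commute[OF S _ that]) (use S_comm in auto)
  then show ?thesis
    unfolding Inn_group_def
    by (intro group.group_comm_groupI B.subgroup_imp_group[OF subgroup_Inn]) auto
qed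

text \<open>The bijections under which \<open>h\<close> is invariant form a subgroup of \<^term>\<open>BijGroup X\<close>, so an
  invariant of the generators is constant on the orbits of the inner automorphism group.\<close>

lemma (in quandle) connected_quandle_invariant:
  assumes conn: "connected_quandle X s"
    and inv: "\<And>x y. \<lbrakk>x \<in> X; y \<in> X\<rbrakk> \<Longrightarrow> h (s x y) = h y"
    and xy: "x \<in> X" "y \<in> X"
  shows "h x = h y"
proof -
  define K where "K = {f \<in> Bij X. \<forall>y\<in>X. h (f y) = h y}"
  have "subgroup K (BijGroup X)"
  proof (rule subgroup_BijGroupI)
    fix f assume f: "f \<in> K"
    then have B: "f \<in> Bij X" by (simp add: K_def)
    have "h (inv_into X f y) = h y" if "y \<in> X" for y
      using f Bij_inv_into_simps(2,3)[OF B that] unfolding K_def by force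
    then show "restrict (inv_into X f) X \<in> K"
      using restrict_inv_into_Bij[OF B] by (simp add: K_def)
  next
    fix f g assume "f \<in> K" "g \<in> K"
    then show "compose X f g \<in> K"
      by (simp add: K_def compose_Bij compose_eq Bij_inv_into_simps(1))
  qed (auto simp: K_def id_Bij)
  moreover have "(\<lambda>x. restrict (s x) X) ` X \<subseteq> K"
    using inv restrict_s_Bij by (auto simp: K_def)
  ultimately have "carrier (Inn_group X s) \<subseteq> K"
    using group.generate_subgroup_incl[OF group_BijGroup] by (simp add: Inn_group_def)
  moreover obtain f where "f \<in> carrier (Inn_group X s)" "f x = y"
    using conn xy unfolding connected_quandle_iff by blast
  ultimately show ?thesis
    using xy(1) by (auto simp: K_def)
qed

section \<open>The quandle of a graph\<close>

lemma QG_map_simp [simp]: "QG_map G (v, a) (w, b) = (w, b + adjacency G v w)"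
  by (simp add: QG_map_def)

lemma fst_QG_map [simp]: "fst (QG_map G x y) = fst y"
  by (cases x; cases y) simp

lemma QG_map_moves_iff: "QG_map G x y \<noteq> y \<longleftrightarrow> (fst x, fst y) \<in> parcs G"
  by (cases x; cases y) (simp add: adjacency_def del: add_bit_eq_xor)

lemma QG_set_iff [simp]: "x \<in> QG_set G \<longleftrightarrow> fst x \<in> pverts G"
  by (cases x) (simp add: QG_set_def)

lemma QG_map_commute: "QG_map G x (QG_map G y z) = QG_map G y (QG_map G x z)"
  by (cases x; cases y; cases z) (simp add: ac_simps del: add_bit_eq_xor)

text \<open>Characteristic \<open>2\<close>: a translation by a bit is its own inverse.\<close>

lemma QG_map_involutive: "QG_map G x (QG_map G x y) = y"
  by (cases x; cases y) (simp add: add.assoc del: add_bit_eq_xor)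

lemma (in pair_loopfree_digraph) quandle_QG: "quandle (QG_set G) (QG_map G)"
proof
  fix x y z
  show "QG_map G x x = x"
    using QG_map_moves_iff[of G x x] pair_no_loops by force
  show "bij_betw (QG_map G x) (QG_set G) (QG_set G)"
    by (rule bij_betw_byWitness[where f' = "QG_map G x"]) (auto simp: QG_map_involutive)
  \<comment> \<open>\<open>s\<^sub>u\<close> depends only on the vertex under \<open>u\<close>, and \<open>s\<^sub>x\<close> does not change that vertex.\<close>
  have "QG_map G (QG_map G x y) = QG_map G y"
    by (cases x; cases y) (simp add: fun_eq_iff)
  then show "QG_map G x (QG_map G y z) = QG_map G (QG_map G x y) (QG_map G x z)"
    by (simp add: QG_map_commute)
qed

text \<open>The projection to the vertices is an invariant, so connectedness leaves at most one vertex.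
  Over one loopless vertex the identity itself is an invariant, contradicting the two elements of
  the fibre.\<close>

lemma (in pair_loopfree_digraph) not_connected_QG:
  assumes "pverts G \<noteq> {}"
  shows "\<not> connected_quandle (QG_set G) (QG_map G)"
proof
  interpret Q: quandle "QG_set G" "QG_map G" by (rule quandle_QG)
  assume conn: "connected_quandle (QG_set G) (QG_map G)"
  obtain v where v: "v \<in> pverts G" using assms by blast
  have "fst x = fst y" if "x \<in> QG_set G" "y \<in> QG_set G" for x y
    by (rule Q.connected_quandle_invariant[OF conn _ that]) simp
  then have "QG_map G x y = y" if "x \<in> QG_set G" "y \<in> QG_set G" for x y
    using that QG_map_moves_iff[of G x y] pair_no_loops[of "(fst x, fst y)"] by auto
  then have "(v, 0 :: bit) = (v, 1)"
    by (rule Q.connected_quandle_invariant[OF conn, where h = "\<lambda>x. x"]) (simp_all add: v)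
  then show False by simp
qed

section \<open>Automorphisms of a graph and of its quandle\<close>

text \<open>The shift \<open>c\<close> is needed to reach both points of a fibre.\<close>

lemma quandle_aut_liftI:
  assumes g: "g \<in> graph_aut G"
  shows "(\<lambda>x\<in>QG_set G. (g (fst x), snd x + c)) \<in> quandle_aut (QG_set G) (QG_map G)"
proof -
  have B: "g \<in> Bij (pverts G)" using g by (simp add: graph_aut_def)
  have "bij_betw (\<lambda>x. (g (fst x), snd x + c)) (QG_set G) (QG_set G)"
    by (rule bij_betw_byWitness[where f' = "\<lambda>x. (inv_into (pverts G) g (fst x), snd x + c)"])
      (auto simp: Bij_inv_into_simps[OF B] add.assoc simp del: add_bit_eq_xor)
  moreover have "adjacency G (g v) (g w) = adjacency G v w"
    if "v \<in> pverts G" "w \<in> pverts G" for v w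
    using g that by (simp add: graph_aut_def adjacency_def)
  ultimately show ?thesis
    using Bij_inv_into_simps(1)[OF B]
    by (auto simp: quandle_aut_def Bij_def ac_simps simp del: add_bit_eq_xor)
qed

text \<open>Adjacency is the statement that \<open>s\<^sub>x\<close> moves \<open>y\<close>, which involves only the quandle structure.\<close>

lemma quandle_aut_arc_iff:
  assumes f: "f \<in> quandle_aut (QG_set G) (QG_map G)"
    and xy: "x \<in> QG_set G" "y \<in> QG_set G"
  shows "(fst (f x), fst (f y)) \<in> parcs G \<longleftrightarrow> (fst x, fst y) \<in> parcs G"
proof -
  have "inj_on f (QG_set G)"
    using f by (auto simp: quandle_aut_def Bij_def bij_betw_def)
  then have "f (QG_map G x y) = f y \<longleftrightarrow> QG_map G x y = y"
    using xy by (intro inj_on_eq_iff) auto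
  moreover have "f (QG_map G x y) = QG_map G (f x) (f y)"
    using f xy by (auto simp: quandle_aut_def)
  ultimately show ?thesis
    by (metis QG_map_moves_iff)
qed

text \<open>The neighbour condition excludes automorphisms that tear a fibre apart: over isolated vertices
  every permutation of the points is compatible with the quandle structure, whatever the fibres.\<close>

lemma graph_aut_descendI:
  assumes f: "f \<in> quandle_aut (QG_set G) (QG_map G)"
    and nbr: "\<And>w. w \<in> pverts G \<Longrightarrow> \<exists>u\<in>pverts G. (u, w) \<in> parcs G"
  shows "(\<lambda>v\<in>pverts G. fst (f (v, 0))) \<in> graph_aut G"
proof (rule restrict_in_graph_autI)
  let ?F = "\<lambda>v. fst (f (v, 0))"
  have B: "f \<in> Bij (QG_set G)" using f by (simp add: quandle_aut_def)
  have closed: "fst (f x) \<in> pverts G" if "fst x \<in> pverts G" for x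
    using Bij_inv_into_simps(1)[OF B, of x] that by simp
  have inj: "inj_on f (QG_set G)" and surj: "f ` QG_set G = QG_set G"
    using B by (auto simp: Bij_def bij_betw_def)
  have fibre: "fst (f (w, b)) = ?F w" if w: "w \<in> pverts G" for w b
  proof (cases b)
    case one
    obtain u where u: "u \<in> pverts G" "(u, w) \<in> parcs G" using nbr[OF w] by blast
    \<comment> \<open>A neighbour of \<open>w\<close> exchanges the points of its fibre, and quandle maps preserve fibres.\<close>
    then have "(w, 1) = QG_map G (u, 0) (w, 0)" by (simp add: adjacency_def)
    moreover have "f (QG_map G (u, 0) (w, 0)) = QG_map G (f (u, 0)) (f (w, 0))"
      using f u w by (simp add: quandle_aut_def del: QG_map_simp)
    ultimately have "f (w, 1) = QG_map G (f (u, 0)) (f (w, 0))" by (simp only:)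
    with one show ?thesis by simp
  qed simp
  have "bij_betw ?F (pverts G) (pverts G)"
  proof (rule bij_betw_imageI)
    show "inj_on ?F (pverts G)"
    proof (rule inj_onI)
      fix v w assume vw: "v \<in> pverts G" "w \<in> pverts G" "?F v = ?F w"
      \<comment> \<open>The points \<open>f (v, 0)\<close> and \<open>f (v, 1)\<close> are distinct, so they exhaust the fibre over
        \<open>?F v\<close>, which also contains \<open>f (w, 0)\<close>.\<close>
      have "f (v, 0) \<noteq> f (v, 1)"
        using inj_on_eq_iff[OF inj, of "(v, 0)" "(v, 1)"] vw by simp
      then have "snd (f (v, 0)) \<noteq> snd (f (v, 1))"
        using fibre[OF vw(1), of 1] by (simp add: prod_eq_iff)
      then have "snd (f (w, 0)) = snd (f (v, 0)) \<or> snd (f (w, 0)) = snd (f (v, 1))"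
        by (cases "snd (f (w, 0))"; cases "snd (f (v, 0))"; cases "snd (f (v, 1))") simp_all
      then have "f (w, 0) = f (v, 0) \<or> f (w, 0) = f (v, 1)"
        using vw(3) fibre[OF vw(1), of 1] by (simp add: prod_eq_iff)
      then show "v = w"
        using inj_on_eq_iff[OF inj, of "(w, 0)"] vw(1,2) by auto
    qed
    show "?F ` pverts G = pverts G"
    proof
      show "pverts G \<subseteq> ?F ` pverts G"
      proof
        fix v assume "v \<in> pverts G"
        then have "(v, 0) \<in> f ` QG_set G" using surj by simp
        then obtain w b where "w \<in> pverts G" "f (w, b) = (v, 0)"
          by (metis QG_set_iff imageE prod.collapse)
        then show "v \<in> ?F ` pverts G" using fibre[of w b] by (intro image_eqI) auto
      qed
    qed (use closed in auto)
  qed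
  then show "restrict ?F (pverts G) \<in> Bij (pverts G)"
    by (simp add: Bij_def)
  show "(v, w) \<in> parcs G \<longleftrightarrow> (?F v, ?F w) \<in> parcs G"
    if "v \<in> pverts G" "w \<in> pverts G" for v w
    using quandle_aut_arc_iff[OF f, of "(v, 0)" "(w, 0)"] that by simp
qed

lemma vertex_transitive_no_arcs:
  assumes "parcs G = {}"
  shows "vertex_transitive G"
  unfolding vertex_transitive_iff
proof (intro ballI)
  fix v w assume vw: "v \<in> pverts G" "w \<in> pverts G"
  let ?t = "restrict (transpose v w) (pverts G)"
  have "bij_betw (transpose v w) (pverts G) (pverts G)"
    using vw by (intro bij_betw_byWitness[where f' = "transpose v w"])
      (auto simp: transpose_def)
  then have "?t \<in> graph_aut G"
    using assms by (intro restrict_in_graph_autI) (auto simp: Bij_def)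
  moreover have "?t v = w" using vw by simp
  ultimately show "\<exists>f\<in>graph_aut G. f v = w" by blast
qed

lemma (in pair_loopfree_digraph) homogeneous_QG_iff_vertex_transitive:
  "homogeneous_quandle (QG_set G) (QG_map G) \<longleftrightarrow> vertex_transitive G"
proof
  interpret Q: quandle "QG_set G" "QG_map G" by (rule quandle_QG)
  assume hom: "homogeneous_quandle (QG_set G) (QG_map G)"
  have aut: "\<exists>f\<in>quandle_aut (QG_set G) (QG_map G). f (v, 0) = (w, 0)"
    if "v \<in> pverts G" "w \<in> pverts G" for v w
    using hom that unfolding Q.homogeneous_quandle_iff by simp
  show "vertex_transitive G"
  proof (cases "parcs G = {}")
    case True
    then show ?thesis by (rule vertex_transitive_no_arcs)
  next
    case False
    then obtain u v where uv: "(u, v) \<in> parcs G" by auto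
    then have V: "u \<in> pverts G" "v \<in> pverts G"
      using arc_fst_in_verts arc_snd_in_verts by force+
    \<comment> \<open>Homogeneity transports the neighbour \<open>u\<close> of \<open>v\<close> to a neighbour of any other vertex.\<close>
    have nbr: "\<exists>u\<in>pverts G. (u, w) \<in> parcs G" if w: "w \<in> pverts G" for w
    proof -
      obtain f where f: "f \<in> quandle_aut (QG_set G) (QG_map G)" "f (v, 0) = (w, 0)"
        using aut[OF V(2) w] by blast
      have "(fst (f (u, 0)), w) \<in> parcs G"
        using quandle_aut_arc_iff[OF f(1), of "(u, 0)" "(v, 0)"] uv V f(2) by simp
      then show ?thesis using arc_fst_in_verts by force
    qed
    show ?thesis
      unfolding vertex_transitive_iff
    proof (intro ballI)
      fix v w assume vw: "v \<in> pverts G" "w \<in> pverts G"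
      obtain f where f: "f \<in> quandle_aut (QG_set G) (QG_map G)" "f (v, 0) = (w, 0)"
        using aut[OF vw] by blast
      show "\<exists>g\<in>graph_aut G. g v = w"
        by (rule bexI[OF _ graph_aut_descendI[OF f(1) nbr]]) (simp_all add: vw f(2))
    qed
  qed
next
  interpret Q: quandle "QG_set G" "QG_map G" by (rule quandle_QG)
  assume vt: "vertex_transitive G"
  show "homogeneous_quandle (QG_set G) (QG_map G)"
    unfolding Q.homogeneous_quandle_iff
  proof (intro ballI)
    fix x y assume xy: "x \<in> QG_set G" "y \<in> QG_set G"
    then obtain g where g: "g \<in> graph_aut G" "g (fst x) = fst y"
      using vt unfolding vertex_transitive_iff by auto
    \<comment> \<open>In characteristic \<open>2\<close>, the shift taking \<open>snd x\<close> to \<open>snd y\<close> is their sum.\<close>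
    have "snd x + (snd x + snd y) = snd y"
      by (simp flip: add.assoc del: add_bit_eq_xor)
    then have "(\<lambda>z\<in>QG_set G. (g (fst z), snd z + (snd x + snd y))) x = y"
      using xy g(2) by (simp del: add_bit_eq_xor)
    then show "\<exists>f\<in>quandle_aut (QG_set G) (QG_map G). f x = y"
      using quandle_aut_liftI[OF g(1)] by blast
  qed
qed

theorem theorem1p3:
  fixes G :: "'v pair_pre_digraph"
  assumes "simple_graph G"
    and "pverts G \<noteq> {}"
  shows "quandle (QG_set G) (QG_map G)
    \<and> \<not> connected_quandle (QG_set G) (QG_map G)
    \<and> comm_group (Inn_group (QG_set G) (QG_map G))
    \<and> (homogeneous_quandle (QG_set G) (QG_map G) \<longleftrightarrow> vertex_transitive G)"
proof -
  interpret pair_bidirected_digraph G by (rule assms(1))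
  interpret Q: quandle "QG_set G" "QG_map G" by (rule quandle_QG)
  show ?thesis
    using Q.quandle_axioms not_connected_QG[OF assms(2)] Q.comm_group_InnI[OF QG_map_commute]
      homogeneous_QG_iff_vertex_transitive
    by blast
qed

end
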